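(* Let $T,S\in G$ be two hyperbolic isometries with $TS=ST$. Then $T$ and $S$ have the same fixed points, i.e. the induced maps $\widetilde{T}$ and $\widetilde{S}$ have the same fixed points in $\overline{B}$.
   Context: $H$ is a complex Hilbert space with inner product $\langle\cdot,\cdot\rangle$ (linear in the first variable), $B$ its open unit ball. $\mathcal{A}((x,z),(y,w))=\langle x,y\rangle-z\overline{w}$ is a Hermitian form on $H\oplus\mathbb{C}$. $G$ is the group of all bijective bounded linear operators on $H\oplus\mathbb{C}$ preserving $\mathcal{A}$; its elements are called isometries. Each $T\in G$ acts on $\overline{B}$ by $\widetilde{T}(x)=y/w$ where $T(x,1)=(y,w)$. $T$ is elliptic if $\widetilde{T}$ has a fixed point in $B$; $T$ is hyperbolic if it is not elliptic and $\widetilde{T}$ has exactly two fixed points in $\overline{B}$, lying on $\partial B$. *)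

theory Defs
  imports "HOL-Analysis.Analysis"
begin

text \<open>
  Complex Hilbert spaces, with the inner product linear in the \<^emph>\<open>first\<close> argument.
  Building on \<^class>\<open>real_inner\<close> makes the norm the one induced by \<open>cinner\<close>, because
  \<open>cinner x x\<close> is real with value \<open>inner x x\<close>; positive definiteness is inherited as well.
\<close>

class complex_hilbert_space = real_inner + complete_space +
  fixes scaleC :: "complex \<Rightarrow> 'a \<Rightarrow> 'a"  (infixr \<open>*\<^sub>C\<close> 75)
    and cinner :: "'a \<Rightarrow> 'a \<Rightarrow> complex"
  assumes scaleC_add_right: "c *\<^sub>C (x + y) = c *\<^sub>C x + c *\<^sub>C y"
    and scaleC_add_left: "(c + d) *\<^sub>C x = c *\<^sub>C x + d *\<^sub>C x"
    and scaleC_scaleC: "c *\<^sub>C (d *\<^sub>C x) = (c * d) *\<^sub>C x"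
    and scaleR_scaleC: "scaleR r x = complex_of_real r *\<^sub>C x"
    and cinner_add_left: "cinner (x + y) z = cinner x z + cinner y z"
    and cinner_scaleC_left: "cinner (c *\<^sub>C x) y = c * cinner x y"
    and cinner_commute: "cinner x y = cnj (cinner y x)"
    and inner_eq_Re_cinner: "inner x y = Re (cinner x y)"

instantiation complex :: complex_hilbert_space
begin

definition scaleC_complex :: "complex \<Rightarrow> complex \<Rightarrow> complex" where
  "scaleC_complex c x = c * x"

definition cinner_complex :: "complex \<Rightarrow> complex \<Rightarrow> complex" where
  "cinner_complex x y = x * cnj y"

instance
  by standard
    (simp_all add: scaleC_complex_def cinner_complex_def algebra_simps
      scaleR_conv_of_real inner_complex_def)

end

instantiation prod :: (complex_hilbert_space, complex_hilbert_space) complex_hilbert_space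
begin

definition scaleC_prod :: "complex \<Rightarrow> 'a \<times> 'b \<Rightarrow> 'a \<times> 'b" where
  "scaleC_prod c u = (c *\<^sub>C fst u, c *\<^sub>C snd u)"

definition cinner_prod :: "'a \<times> 'b \<Rightarrow> 'a \<times> 'b \<Rightarrow> complex" where
  "cinner_prod u v = cinner (fst u) (fst v) + cinner (snd u) (snd v)"

instance
proof
  fix u v :: "'a \<times> 'b"
  show "cinner u v = cnj (cinner v u)"
    unfolding cinner_prod_def
    by (metis cinner_commute complex_cnj_add)
qed (simp_all add: scaleC_prod_def cinner_prod_def scaleC_add_right scaleC_add_left
      scaleC_scaleC scaleR_scaleC cinner_add_left cinner_scaleC_left inner_eq_Re_cinner
      inner_prod_def scaleR_prod_def algebra_simps)

end

definition bounded_clinear ::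
    "('a::complex_hilbert_space \<Rightarrow> 'b::complex_hilbert_space) \<Rightarrow> bool" where
  "bounded_clinear T \<longleftrightarrow> bounded_linear T \<and> (\<forall>c u. T (c *\<^sub>C u) = c *\<^sub>C T u)"

definition herm_form ::
    "'a::complex_hilbert_space \<times> complex \<Rightarrow> 'a \<times> complex \<Rightarrow> complex" where
  "herm_form u v = cinner (fst u) (fst v) - snd u * cnj (snd v)"

definition isometries ::
    "('a::complex_hilbert_space \<times> complex \<Rightarrow> 'a \<times> complex) set" where
  "isometries = {T. bij T \<and> bounded_clinear T \<and>
     (\<forall>u v. herm_form (T u) (T v) = herm_form u v)}"

text \<open>
  The map \<open>x \<mapsto> y/w\<close> with \<open>T (x, 1) = (y, w)\<close>. It is only used on the closed unit ball, where
  \<open>w\<close> is nonzero for every isometry \<open>T\<close>: the form is nonpositive at \<open>(x, 1)\<close>, so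
  \<open>norm y \<le> norm w\<close>, and \<open>w = 0\<close> would force \<open>T (x, 1) = 0\<close>.
\<close>

definition induced_map ::
    "('a::complex_hilbert_space \<times> complex \<Rightarrow> 'a \<times> complex) \<Rightarrow> 'a \<Rightarrow> 'a" where
  "induced_map T x = (case T (x, 1) of (y, w) \<Rightarrow> inverse w *\<^sub>C y)"

definition fixed_points ::
    "('a::complex_hilbert_space \<times> complex \<Rightarrow> 'a \<times> complex) \<Rightarrow> 'a set" where
  "fixed_points T = {x \<in> cball 0 1. induced_map T x = x}"

definition elliptic ::
    "('a::complex_hilbert_space \<times> complex \<Rightarrow> 'a \<times> complex) \<Rightarrow> bool" where
  "elliptic T \<longleftrightarrow> (\<exists>x \<in> ball 0 1. induced_map T x = x)"

definition hyperbolic ::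
    "('a::complex_hilbert_space \<times> complex \<Rightarrow> 'a \<times> complex) \<Rightarrow> bool" where
  "hyperbolic T \<longleftrightarrow> \<not> elliptic T \<and> card (fixed_points T) = 2 \<and> fixed_points T \<subseteq> sphere 0 1"

end

theory Submission
  imports Defs
begin

text \<open>
  Fixed points of \<open>induced_map T\<close> correspond to eigenvectors \<open>(x, 1)\<close> of \<open>T\<close>. Since \<open>S\<close> commutes
  with \<open>T\<close>, it permutes the two fixed points \<open>a\<close>, \<open>b\<close> of \<open>T\<close>. If \<open>S\<close> fixes both, counting finishes
  the proof. If it swaps them, then the plane spanned by \<open>(a, 1)\<close> and \<open>(b, 1)\<close> contains an
  eigenvector of \<open>S\<close> on which the form is negative; rescaled to last coordinate 1, it is a fixed
  point of \<open>S\<close> inside the open ball, so that \<open>S\<close> would be elliptic.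
\<close>

lemma cinner_add_right:
  "cinner x (y + z) = cinner x y + cinner x z"
  by (metis cinner_add_left cinner_commute complex_cnj_add)

lemma cinner_scaleC_right:
  "cinner x (c *\<^sub>C y) = cnj c * cinner x y"
  by (metis cinner_commute cinner_scaleC_left complex_cnj_mult)

lemma scaleC_one [simp]: "1 *\<^sub>C (x::'a::complex_hilbert_space) = x"
  using scaleR_scaleC[of 1 x] by simp

lemma scaleC_zero_left [simp]: "0 *\<^sub>C (x::'a::complex_hilbert_space) = 0"
  using scaleR_scaleC[of 0 x] by simp

text \<open>The class fixes only the real part through \<open>inner\<close>; Hermitian symmetry
  removes the imaginary part.\<close>

lemma cinner_self: "cinner x x = of_real ((norm x)\<^sup>2)"
proof -
  have "Im (cinner x x) = 0"
    using arg_cong[OF cinner_commute[of x x], of Im] by simp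
  then show ?thesis
    by (simp add: complex_eq_iff dot_square_norm flip: inner_eq_Re_cinner)
qed

lemma norm_scaleC: "norm (c *\<^sub>C x) = cmod c * norm x"
proof -
  have "complex_of_real ((norm (c *\<^sub>C x))\<^sup>2) = c * cnj c * of_real ((norm x)\<^sup>2)"
    by (simp only: cinner_self[symmetric] cinner_scaleC_left cinner_scaleC_right mult_ac)
  also have "\<dots> = of_real ((cmod c * norm x)\<^sup>2)"
    by (simp add: power_mult_distrib flip: complex_norm_square)
  finally show ?thesis
    by (simp only: of_real_eq_iff power2_eq_iff_nonneg norm_ge_zero mult_nonneg_nonneg)
qed

lemma norm_inverse_scaleC: "norm (inverse c *\<^sub>C x) = norm x / cmod c"
  by (simp add: norm_scaleC norm_inverse divide_inverse mult.commute)

lemma herm_form_add_left: "herm_form (u + v) w = herm_form u w + herm_form v w"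
  by (simp add: herm_form_def cinner_add_left algebra_simps)

lemma herm_form_add_right: "herm_form u (v + w) = herm_form u v + herm_form u w"
  by (simp add: herm_form_def cinner_add_right algebra_simps)

lemma herm_form_scaleC_left: "herm_form (c *\<^sub>C u) v = c * herm_form u v"
  by (simp add: herm_form_def scaleC_prod_def scaleC_complex_def cinner_scaleC_left algebra_simps)

lemma herm_form_scaleC_right: "herm_form u (c *\<^sub>C v) = cnj c * herm_form u v"
  by (simp add: herm_form_def scaleC_prod_def scaleC_complex_def cinner_scaleC_right algebra_simps)

lemma herm_form_commute: "herm_form u v = cnj (herm_form v u)"
  using cinner_commute[of "fst u" "fst v"] by (simp add: herm_form_def)

lemma herm_form_self: "herm_form u u = of_real ((norm (fst u))\<^sup>2 - (cmod (snd u))\<^sup>2)"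
  by (simp add: herm_form_def cinner_self flip: complex_norm_square)

lemma isometries_add: "T \<in> isometries \<Longrightarrow> T (u + v) = T u + T v"
  by (simp add: isometries_def bounded_clinear_def linear_simps)

lemma isometries_scaleC: "T \<in> isometries \<Longrightarrow> T (c *\<^sub>C u) = c *\<^sub>C T u"
  unfolding isometries_def bounded_clinear_def by blast

lemma isometries_herm_form: "T \<in> isometries \<Longrightarrow> herm_form (T u) (T v) = herm_form u v"
  unfolding isometries_def by blast

lemma isometries_eq_iff: "T \<in> isometries \<Longrightarrow> T u = T v \<longleftrightarrow> u = v"
  by (simp add: isometries_def bij_def inj_eq)

lemma isometries_eq_0_iff: "T \<in> isometries \<Longrightarrow> T u = 0 \<longleftrightarrow> u = 0"
  by (metis isometries_eq_iff isometries_scaleC scaleC_zero_left)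

text \<open>Dividing by the last coordinate cancels \<open>c\<close>. Since
  \<open>inverse 0 = 0\<close>, the scalar has to be nonzero.\<close>

lemma induced_map_eqI:
  assumes "T (x, 1) = c *\<^sub>C (y, 1)" and "c \<noteq> 0"
  shows "induced_map T x = y"
  using assms
  by (simp add: induced_map_def scaleC_prod_def scaleC_complex_def scaleC_scaleC)

text \<open>The form is nonpositive at \<open>(x, 1)\<close> and \<open>T\<close> preserves it, so
  the last coordinate of the image dominates the first; injectivity of \<open>T\<close> keeps it
  from vanishing. Writing the image as a multiple of \<open>(induced_map T x, 1)\<close> lets later
  arguments use linearity.\<close>

lemma isometries_cball:
  assumes T: "T \<in> isometries" and x: "x \<in> cball 0 1"
  obtains c where "c \<noteq> 0" "T (x, 1) = c *\<^sub>C (induced_map T x, 1)" "induced_map T x \<in> cball 0 1"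
proof -
  obtain y w where yw: "T (x, 1) = (y, w)" by fastforce
  have "herm_form (y, w) (y, w) = herm_form (x, 1) (x, 1)"
    using isometries_herm_form[OF T, of "(x, 1)" "(x, 1)"] by (simp add: yw)
  then have "(norm y)\<^sup>2 - (cmod w)\<^sup>2 = (norm x)\<^sup>2 - 1"
    unfolding herm_form_self of_real_eq_iff by simp
  moreover have "(norm x)\<^sup>2 \<le> 1"
    using x by (simp add: power_le_one)
  ultimately have "(norm y)\<^sup>2 \<le> (cmod w)\<^sup>2" by linarith
  then have le: "norm y \<le> cmod w" by (rule power2_le_imp_le) simp
  have w: "w \<noteq> 0"
  proof
    assume "w = 0"
    with le yw have "T (x, 1) = 0" by (simp add: zero_prod_def)
    then have "(x, 1::complex) = 0"
      by (simp only: isometries_eq_0_iff[OF T])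
    then show False
      by (simp add: zero_prod_def)
  qed
  have im: "induced_map T x = inverse w *\<^sub>C y"
    by (simp add: induced_map_def yw)
  show thesis
  proof (rule that[OF w])
    show "T (x, 1) = w *\<^sub>C (induced_map T x, 1)"
      using w by (simp add: yw im scaleC_prod_def scaleC_complex_def scaleC_scaleC)
    show "induced_map T x \<in> cball 0 1"
      using le w by (simp add: im norm_inverse_scaleC)
  qed
qed

lemma fixed_points_eigenvector:
  assumes "T \<in> isometries" and "x \<in> fixed_points T"
  obtains c where "c \<noteq> 0" "T (x, 1) = c *\<^sub>C (x, 1)"
  using isometries_cball[of T x] assms by (auto simp: fixed_points_def)

text \<open>By commutation, \<open>S\<close> sends an eigenvector of \<open>T\<close> to an
  eigenvector with the same eigenvalue; rescaling does not affect this.\<close>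

lemma induced_map_commuting_fixed_points:
  assumes T: "T \<in> isometries" and S: "S \<in> isometries" and comm: "T \<circ> S = S \<circ> T"
    and x: "x \<in> fixed_points T"
  shows "induced_map S x \<in> fixed_points T"
proof -
  obtain l where l: "l \<noteq> 0" "T (x, 1) = l *\<^sub>C (x, 1)"
    using fixed_points_eigenvector[OF T x] .
  obtain c where c: "c \<noteq> 0" "S (x, 1) = c *\<^sub>C (induced_map S x, 1)" "induced_map S x \<in> cball 0 1"
    using isometries_cball[OF S, of x] x by (auto simp: fixed_points_def)
  have e: "(induced_map S x, 1) = inverse c *\<^sub>C S (x, 1)"
    using c by (simp only: scaleC_scaleC) simp
  have "T (S (x, 1)) = l *\<^sub>C S (x, 1)"
    using fun_cong[OF comm, of "(x, 1)"] by (simp add: l isometries_scaleC[OF S])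
  then have "T (induced_map S x, 1) = l *\<^sub>C (induced_map S x, 1)"
    by (simp add: e isometries_scaleC[OF T] scaleC_scaleC mult.commute)
  then have "induced_map T (induced_map S x) = induced_map S x"
    using l(1) by (rule induced_map_eqI)
  then show ?thesis
    using c(3) by (simp add: fixed_points_def)
qed

text \<open>Equal images make \<open>S (x, 1)\<close> and \<open>S (y, 1)\<close> proportional,
  hence also \<open>(x, 1)\<close> and \<open>(y, 1)\<close>, whose last coordinates agree.\<close>

lemma inj_on_induced_map:
  assumes S: "S \<in> isometries"
  shows "inj_on (induced_map S) (cball 0 1)"
proof (rule inj_onI)
  fix x y assume x: "x \<in> cball 0 1" and y: "y \<in> cball 0 1"
    and eq: "induced_map S x = induced_map S y"
  obtain c where c: "c \<noteq> 0" "S (x, 1) = c *\<^sub>C (induced_map S x, 1)"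
    using isometries_cball[OF S x] .
  obtain d where d: "d \<noteq> 0" "S (y, 1) = d *\<^sub>C (induced_map S x, 1)"
    using isometries_cball[OF S y] eq by metis
  have "S (d *\<^sub>C (x, 1)) = S (c *\<^sub>C (y, 1))"
    by (simp only: isometries_scaleC[OF S] c d scaleC_scaleC mult.commute)
  then have "d *\<^sub>C (x, 1::complex) = c *\<^sub>C (y, 1)"
    by (simp only: isometries_eq_iff[OF S])
  then have "d = c" "d *\<^sub>C x = c *\<^sub>C y"
    by (auto simp: scaleC_prod_def scaleC_complex_def)
  then have "inverse c *\<^sub>C c *\<^sub>C x = inverse c *\<^sub>C c *\<^sub>C y" by simp
  then show "x = y"
    using c(1) by (simp add: scaleC_scaleC)
qed

text \<open>Negativity says that the last coordinate strictly dominates, so dividing by it gives a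
  point of the open ball.\<close>

lemma elliptic_if_negative_eigenvector:
  assumes S: "S \<in> isometries" and u: "S u = l *\<^sub>C u" and neg: "Re (herm_form u u) < 0"
  shows "elliptic S"
proof -
  obtain y w where yw: "u = (y, w)" by fastforce
  have "(norm y)\<^sup>2 < (cmod w)\<^sup>2"
    using neg by (simp add: herm_form_self yw)
  then have lt: "norm y < cmod w"
    by (rule power2_less_imp_less) simp
  then have w: "w \<noteq> 0" by auto
  have e: "(inverse w *\<^sub>C y, 1) = inverse w *\<^sub>C u"
    using w by (simp add: yw scaleC_prod_def scaleC_complex_def)
  have "u \<noteq> 0"
    using w by (simp add: yw zero_prod_def)
  then have "l \<noteq> 0"
    using isometries_eq_0_iff[OF S, of u] u by auto
  moreover have "S (inverse w *\<^sub>C y, 1) = l *\<^sub>C (inverse w *\<^sub>C y, 1)"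
    by (simp add: e isometries_scaleC[OF S] u scaleC_scaleC mult.commute)
  ultimately have "induced_map S (inverse w *\<^sub>C y) = inverse w *\<^sub>C y"
    by (intro induced_map_eqI)
  moreover have "inverse w *\<^sub>C y \<in> ball 0 1"
    using lt w by (simp add: norm_inverse_scaleC)
  ultimately show ?thesis
    unfolding elliptic_def by blast
qed

lemma elliptic_if_swaps_boundary_points:
  assumes S: "S \<in> isometries" and a: "a \<in> sphere 0 1" and b: "b \<in> sphere 0 1" and ab: "a \<noteq> b"
    and Sa: "induced_map S a = b" and Sb: "induced_map S b = a"
  shows "elliptic S"
proof -
  let ?a = "(a, 1::complex)" and ?b = "(b, 1::complex)"
  obtain p where p: "S ?a = p *\<^sub>C ?b"
    using isometries_cball[OF S, of a] a Sa by auto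
  obtain q where q: "q \<noteq> 0" "S ?b = q *\<^sub>C ?a"
    using isometries_cball[OF S, of b] b Sb by auto
  define c where "c = herm_form ?a ?b"
  have ba: "herm_form ?b ?a = cnj c"
    unfolding c_def by (rule herm_form_commute)
  \<comment> \<open>The real part of \<open>c\<close> is \<open>inner a b - 1\<close>, and unit
    vectors with inner product 1 coincide.\<close>
  have c0: "c \<noteq> 0"
  proof
    assume "c = 0"
    then have "inner a b = 1"
      by (simp add: c_def herm_form_def inner_eq_Re_cinner)
    moreover have "inner a a = 1" "inner b b = 1"
      using a b by (simp_all add: dot_square_norm)
    ultimately have "inner (a - b) (a - b) = 0"
      by (simp add: inner_diff inner_commute[of b a])
    then show False using ab by simp
  qed
  \<comment> \<open>Invariance of the form, with the two vectors interchanged up to scalars, ties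
    \<open>p\<close> and \<open>q\<close> to the phase of \<open>c\<close>. This is what allows a
    root of \<open>p / q\<close> to be written explicitly in terms of \<open>c\<close>.\<close>
  have c: "c = p * cnj q * cnj c"
    using isometries_herm_form[OF S, of ?a ?b] ba
    by (simp add: c_def p q herm_form_scaleC_left herm_form_scaleC_right mult_ac)
  \<comment> \<open>\<open>?a + \<beta> *\<^sub>C ?b\<close> is an eigenvector iff \<open>\<beta>\<^sup>2 * q = p\<close>; of the two roots this is the one
    making the form negative.\<close>
  define \<beta> where "\<beta> = - c / of_real (cmod c * cmod q)"
  define u where "u = ?a + \<beta> *\<^sub>C ?b"
  have "c * c = p * cnj q * (c * cnj c)"
    using c by (metis mult.assoc mult.commute)
  then have "\<beta> * \<beta> * q = p * (q * cnj q) * (c * cnj c) / ((c * cnj c) * (q * cnj q))"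
    by (simp add: \<beta>_def power2_eq_square field_simps flip: complex_norm_square)
  then have \<beta>: "\<beta> * q * \<beta> = p"
    using c0 q(1) by (simp add: mult_ac del: complex_mult_cnj)
  have "S u = p *\<^sub>C ?b + (\<beta> * q) *\<^sub>C ?a"
    by (simp only: u_def isometries_add[OF S] isometries_scaleC[OF S] p q scaleC_scaleC)
  also have "\<dots> = (\<beta> * q) *\<^sub>C u"
    by (simp only: u_def scaleC_add_right scaleC_scaleC \<beta> add.commute)
  finally have Su: "S u = (\<beta> * q) *\<^sub>C u" .
  \<comment> \<open>Boundary points give isotropic vectors, so only the cross terms of
    \<open>herm_form u u\<close> survive.\<close>
  have "herm_form ?a ?a = 0" "herm_form ?b ?b = 0"
    using a b by (simp_all add: herm_form_self)
  then have "herm_form u u = cnj \<beta> * c + \<beta> * cnj c"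
    by (simp add: u_def herm_form_add_left herm_form_add_right herm_form_scaleC_left
        herm_form_scaleC_right ba flip: c_def)
  also have "\<dots> = - 2 * (c * cnj c) / of_real (cmod c * cmod q)"
    by (simp add: \<beta>_def field_simps)
  also have "\<dots> = of_real (- 2 * (cmod c)\<^sup>2 / (cmod c * cmod q))"
    by (simp flip: complex_norm_square)
  finally have "Re (herm_form u u) = - 2 * (cmod c)\<^sup>2 / (cmod c * cmod q)"
    by (simp only: Re_complex_of_real)
  also have "\<dots> < 0"
    using c0 q(1) by (simp add: divide_neg_pos)
  finally have "Re (herm_form u u) < 0" .
  with S Su show ?thesis
    by (rule elliptic_if_negative_eigenvector)
qed

theorem corollary1p6p2:
  fixes T S :: "'a::complex_hilbert_space \<times> complex \<Rightarrow> 'a \<times> complex"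
  assumes "T \<in> isometries" and "S \<in> isometries"
    and "hyperbolic T" and "hyperbolic S"
    and "T \<circ> S = S \<circ> T"
  shows "fixed_points T = fixed_points S"
proof -
  obtain a b where ab: "fixed_points T = {a, b}" "a \<noteq> b"
    using assms(3) by (auto simp: hyperbolic_def card_2_iff)
  have sph: "a \<in> sphere 0 1" "b \<in> sphere 0 1"
    using assms(3) ab by (auto simp: hyperbolic_def)
  then have cb: "a \<in> cball 0 1" "b \<in> cball 0 1" by auto
  \<comment> \<open>Together with injectivity this leaves only the identity and the swap on
    \<open>{a, b}\<close>.\<close>
  have "induced_map S a \<in> {a, b}" "induced_map S b \<in> {a, b}"
    using induced_map_commuting_fixed_points[OF assms(1,2,5)] ab by auto
  moreover have "induced_map S a \<noteq> induced_map S b"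
    using inj_onD[OF inj_on_induced_map[OF assms(2)] _ cb] ab(2) by blast
  moreover have "\<not> (induced_map S a = b \<and> induced_map S b = a)"
    using elliptic_if_swaps_boundary_points[OF assms(2) sph ab(2)] assms(4)
    by (auto simp: hyperbolic_def)
  ultimately have "induced_map S a = a" "induced_map S b = b" by auto
  then have "fixed_points T \<subseteq> fixed_points S"
    using ab(1) cb by (auto simp: fixed_points_def)
  moreover have "card (fixed_points S) = 2" "card (fixed_points T) = 2"
    using assms(3,4) by (auto simp: hyperbolic_def)
  \<comment> \<open>Cardinality 2 also forces finiteness, as infinite sets have \<open>card\<close>
    0, so the inclusion is an equality.\<close>
  ultimately show ?thesis
    by (metis card.infinite card_subset_eq zero_neq_numeral)
qed

end
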